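(* Let $A$ be a ring. Every $A$-module that is both $\Sigma$-$\operatorname{D2}$ and $\Sigma$-d-Rickart is $\Sigma$-Rickart.
   Context: Rings are associative with unity and modules are unital right $A$-modules. $X^{(\Lambda)}$ denotes the direct sum of $\Lambda$ copies of $X$, for a non-empty index set $\Lambda$. A module $M$ is Rickart (respectively d-Rickart) if $\operatorname{Ker}(\phi)$ (respectively $\operatorname{Im}(\phi)$) is a direct summand of $M$ for every $\phi\in\operatorname{End}_A(M)$. A module $M$ is a $\operatorname{D2}$-module if every submodule $N\leq M$ such that $M/N$ is isomorphic to a direct summand of $M$ is itself a direct summand of $M$. A module $X$ is $\Sigma$-Rickart (respectively $\Sigma$-d-Rickart, $\Sigma$-$\operatorname{D2}$) if $X^{(\Lambda)}$ is Rickart (respectively d-Rickart, a $\operatorname{D2}$-module) for every non-empty index set $\Lambda$. *)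

theory Defs
  imports "HOL-Algebra.AbelCoset" "HOL-Algebra.Module"
begin

text \<open>
  The library locale \<^locale>\<open>module\<close> assumes a commutative ring. Right modules over an arbitrary
  ring reuse its record type, with \<open>a \<odot>\<^bsub>M\<^esub> x\<close> standing for the right action \<open>x a\<close>; the
  associativity axiom \<open>x (a b) = (x a) b\<close> therefore appears with the factors exchanged.
\<close>

locale right_module = A?: ring A + M?: abelian_group M for A (structure) and M (structure) +
  assumes smult_closed:
      "\<lbrakk>a \<in> carrier A; x \<in> carrier M\<rbrakk> \<Longrightarrow> a \<odot>\<^bsub>M\<^esub> x \<in> carrier M"
    and smult_add_ring:
      "\<lbrakk>a \<in> carrier A; b \<in> carrier A; x \<in> carrier M\<rbrakk> \<Longrightarrow>
        (a \<oplus>\<^bsub>A\<^esub> b) \<odot>\<^bsub>M\<^esub> x = (a \<odot>\<^bsub>M\<^esub> x) \<oplus>\<^bsub>M\<^esub> (b \<odot>\<^bsub>M\<^esub> x)"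
    and smult_add_module:
      "\<lbrakk>a \<in> carrier A; x \<in> carrier M; y \<in> carrier M\<rbrakk> \<Longrightarrow>
        a \<odot>\<^bsub>M\<^esub> (x \<oplus>\<^bsub>M\<^esub> y) = (a \<odot>\<^bsub>M\<^esub> x) \<oplus>\<^bsub>M\<^esub> (a \<odot>\<^bsub>M\<^esub> y)"
    and smult_assoc:
      "\<lbrakk>a \<in> carrier A; b \<in> carrier A; x \<in> carrier M\<rbrakk> \<Longrightarrow>
        (a \<otimes>\<^bsub>A\<^esub> b) \<odot>\<^bsub>M\<^esub> x = b \<odot>\<^bsub>M\<^esub> (a \<odot>\<^bsub>M\<^esub> x)"
    and smult_one:
      "x \<in> carrier M \<Longrightarrow> \<one>\<^bsub>A\<^esub> \<odot>\<^bsub>M\<^esub> x = x"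

text \<open>
  Homomorphisms are constrained on carriers only. Kernels are given by the library's
  \<^const>\<open>a_kernel\<close>, and submodules by its locale \<^locale>\<open>submodule\<close>, which
  does not require the ring to be commutative.
\<close>

definition module_hom ::
  "('a, 'r) ring_scheme \<Rightarrow> ('a, 'm, 's) module_scheme \<Rightarrow> ('a, 'n, 't) module_scheme \<Rightarrow> ('m \<Rightarrow> 'n) set"
  where "module_hom A M N =
    {f \<in> hom (add_monoid M) (add_monoid N).
      \<forall>a\<in>carrier A. \<forall>x\<in>carrier M. f (a \<odot>\<^bsub>M\<^esub> x) = a \<odot>\<^bsub>N\<^esub> f x}"

abbreviation module_End ::
  "('a, 'r) ring_scheme \<Rightarrow> ('a, 'm, 's) module_scheme \<Rightarrow> ('m \<Rightarrow> 'm) set"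
  where "module_End A M \<equiv> module_hom A M M"

definition module_isomorphic ::
  "('a, 'r) ring_scheme \<Rightarrow> ('a, 'm, 's) module_scheme \<Rightarrow> ('a, 'n, 't) module_scheme \<Rightarrow> bool"
  where "module_isomorphic A M N \<longleftrightarrow>
    (\<exists>f\<in>module_hom A M N. bij_betw f (carrier M) (carrier N))"

definition direct_summand ::
  "('a, 'r) ring_scheme \<Rightarrow> ('a, 'm, 's) module_scheme \<Rightarrow> 'm set \<Rightarrow> bool"
  where "direct_summand A M N \<longleftrightarrow> submodule N A M \<and>
    (\<exists>K. submodule K A M \<and> N <+>\<^bsub>M\<^esub> K = carrier M \<and> N \<inter> K = {\<zero>\<^bsub>M\<^esub>})"

text \<open>
  The record type of modules inherits the ring fields \<^const>\<open>monoid.mult\<close> and \<^const>\<open>one\<close>, which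
  play no role for modules and are left unspecified in the two constructions below.
  For a coset \<open>X = N +> x\<close> of a submodule \<open>N\<close>, the union defining
  the scalar action collapses to the single coset \<open>N +> (a \<odot> x)\<close>.
\<close>

definition quotient_module :: "('a, 'm, 's) module_scheme \<Rightarrow> 'm set \<Rightarrow> ('a, 'm set) module"
  where "quotient_module M N =
    \<lparr>carrier = a_rcosets\<^bsub>M\<^esub> N, monoid.mult = undefined, one = undefined,
     zero = N, add = (<+>\<^bsub>M\<^esub>), smult = (\<lambda>a X. \<Union>x\<in>X. N +>\<^bsub>M\<^esub> (a \<odot>\<^bsub>M\<^esub> x))\<rparr>"

definition direct_power :: "('a, 'm, 's) module_scheme \<Rightarrow> 'i set \<Rightarrow> ('a, 'i \<Rightarrow> 'm) module"
  where "direct_power X \<Lambda> =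
    \<lparr>carrier = {f \<in> \<Lambda> \<rightarrow>\<^sub>E carrier X. finite {i \<in> \<Lambda>. f i \<noteq> \<zero>\<^bsub>X\<^esub>}},
     monoid.mult = undefined, one = undefined,
     zero = (\<lambda>i\<in>\<Lambda>. \<zero>\<^bsub>X\<^esub>), add = (\<lambda>f g. \<lambda>i\<in>\<Lambda>. f i \<oplus>\<^bsub>X\<^esub> g i),
     smult = (\<lambda>a f. \<lambda>i\<in>\<Lambda>. a \<odot>\<^bsub>X\<^esub> f i)\<rparr>"

definition rickart :: "('a, 'r) ring_scheme \<Rightarrow> ('a, 'm, 's) module_scheme \<Rightarrow> bool"
  where "rickart A M \<longleftrightarrow> (\<forall>\<phi>\<in>module_End A M. direct_summand A M (a_kernel M M \<phi>))"

definition d_rickart :: "('a, 'r) ring_scheme \<Rightarrow> ('a, 'm, 's) module_scheme \<Rightarrow> bool"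
  where "d_rickart A M \<longleftrightarrow> (\<forall>\<phi>\<in>module_End A M. direct_summand A M (\<phi> ` carrier M))"

definition D2_module :: "('a, 'r) ring_scheme \<Rightarrow> ('a, 'm, 's) module_scheme \<Rightarrow> bool"
  where "D2_module A M \<longleftrightarrow>
    (\<forall>N. submodule N A M \<longrightarrow>
      (\<exists>K. direct_summand A M K \<and>
        module_isomorphic A (quotient_module M N) (M\<lparr>carrier := K\<rparr>)) \<longrightarrow>
      direct_summand A M N)"

text \<open>
  HOL cannot quantify over types inside a formula, so ``every non-empty index set'' means every
  non-empty set of elements of a type \<open>'i\<close>, which is passed as an explicit parameter.
  Each property depends on \<open>\<Lambda>\<close> only through its cardinality, and a theorem that is
  polymorphic in \<open>'i\<close> covers index sets of every cardinality.
\<close>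

definition Sigma_rickart ::
  "'i itself \<Rightarrow> ('a, 'r) ring_scheme \<Rightarrow> ('a, 'm, 's) module_scheme \<Rightarrow> bool"
  where "Sigma_rickart (_ :: 'i itself) A X \<longleftrightarrow>
    (\<forall>\<Lambda> :: 'i set. \<Lambda> \<noteq> {} \<longrightarrow> rickart A (direct_power X \<Lambda>))"

definition Sigma_d_rickart ::
  "'i itself \<Rightarrow> ('a, 'r) ring_scheme \<Rightarrow> ('a, 'm, 's) module_scheme \<Rightarrow> bool"
  where "Sigma_d_rickart (_ :: 'i itself) A X \<longleftrightarrow>
    (\<forall>\<Lambda> :: 'i set. \<Lambda> \<noteq> {} \<longrightarrow> d_rickart A (direct_power X \<Lambda>))"

definition Sigma_D2 ::
  "'i itself \<Rightarrow> ('a, 'r) ring_scheme \<Rightarrow> ('a, 'm, 's) module_scheme \<Rightarrow> bool"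
  where "Sigma_D2 (_ :: 'i itself) A X \<longleftrightarrow>
    (\<forall>\<Lambda> :: 'i set. \<Lambda> \<noteq> {} \<longrightarrow> D2_module A (direct_power X \<Lambda>))"

end

theory Submission
  imports Defs
begin

text \<open>
  For an endomorphism \<open>\<phi>\<close> of a direct power \<open>P\<close>, the quotient \<open>P / Ker \<phi>\<close> is isomorphic to
  \<open>Im \<phi>\<close>, which is a direct summand because \<open>P\<close> is d-Rickart; the D2 condition then makes
  \<open>Ker \<phi>\<close> a direct summand. The argument works for one fixed power at a time.
\<close>

lemma (in right_module) smult_zero:
  assumes "a \<in> carrier A"
  shows "a \<odot>\<^bsub>M\<^esub> \<zero>\<^bsub>M\<^esub> = \<zero>\<^bsub>M\<^esub>"
  using smult_add_module[OF assms M.zero_closed M.zero_closed]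
    smult_closed[OF assms M.zero_closed]
  by (metis M.add.r_cancel_one' M.l_zero M.zero_closed)

text \<open>All axioms hold coordinatewise. The point that needs care is finite support: the support
  of a sum lies in the union of the two supports, and scalars do not enlarge a support because they
  fix zero.\<close>

lemma right_module_direct_power:
  assumes "right_module A X"
  shows "right_module A (direct_power X \<Lambda>)"
proof -
  interpret X: right_module A X by fact
  let ?P = "direct_power X \<Lambda>"
  have closed: "f i \<in> carrier X" if "f \<in> carrier ?P" "i \<in> \<Lambda>" for f i
    using that by (auto simp: direct_power_def)
  \<comment> \<open>Members of the power are extensional functions, so agreement on
    \<open>\<Lambda>\<close> suffices. Below, the name \<open>ext\<close> refers to this fact and
    not to function extensionality on the whole type.\<close>
  have ext: "f = g"
    if "f \<in> carrier ?P" "g \<in> carrier ?P" "\<And>i. i \<in> \<Lambda> \<Longrightarrow> f i = g i" for f g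
    using that by (auto simp: direct_power_def intro: PiE_ext)
  \<comment> \<open>\<open>F\<close> need only contain the support, so a bound on the support can be
    supplied instead of the support itself.\<close>
  have memI: "(\<lambda>i\<in>\<Lambda>. h i) \<in> carrier ?P"
    if "\<And>i. i \<in> \<Lambda> \<Longrightarrow> h i \<in> carrier X" "finite F" "\<And>i. i \<in> \<Lambda> - F \<Longrightarrow> h i = \<zero>\<^bsub>X\<^esub>" for h F
    using that by (auto simp: direct_power_def intro: finite_subset[of _ F])
  have supp: "finite {i \<in> \<Lambda>. f i \<noteq> \<zero>\<^bsub>X\<^esub>}" if "f \<in> carrier ?P" for f
    using that by (simp add: direct_power_def)
  have add_closed: "f \<oplus>\<^bsub>?P\<^esub> g \<in> carrier ?P" if "f \<in> carrier ?P" "g \<in> carrier ?P" for f g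
  proof -
    have "(\<lambda>i\<in>\<Lambda>. f i \<oplus>\<^bsub>X\<^esub> g i) \<in> carrier ?P"
      using that
      by (intro memI[of _ "{i \<in> \<Lambda>. f i \<noteq> \<zero>\<^bsub>X\<^esub>} \<union> {i \<in> \<Lambda>. g i \<noteq> \<zero>\<^bsub>X\<^esub>}"])
        (auto simp: closed supp)
    then show ?thesis by (simp add: direct_power_def)
  qed
  have smult_closed: "a \<odot>\<^bsub>?P\<^esub> f \<in> carrier ?P" if "a \<in> carrier A" "f \<in> carrier ?P" for a f
  proof -
    have "(\<lambda>i\<in>\<Lambda>. a \<odot>\<^bsub>X\<^esub> f i) \<in> carrier ?P"
      using that
      by (intro memI[of _ "{i \<in> \<Lambda>. f i \<noteq> \<zero>\<^bsub>X\<^esub>}"])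
        (auto simp: closed supp X.smult_zero X.smult_closed)
    then show ?thesis by (simp add: direct_power_def)
  qed
  have zero_closed: "\<zero>\<^bsub>?P\<^esub> \<in> carrier ?P"
    using memI[of "\<lambda>_. \<zero>\<^bsub>X\<^esub>" "{}"] by (simp add: direct_power_def)
  have add_app: "(f \<oplus>\<^bsub>?P\<^esub> g) i = f i \<oplus>\<^bsub>X\<^esub> g i" if "i \<in> \<Lambda>" for f g i
    using that by (simp add: direct_power_def)
  have smult_app: "(a \<odot>\<^bsub>?P\<^esub> f) i = a \<odot>\<^bsub>X\<^esub> f i" if "i \<in> \<Lambda>" for a f i
    using that by (simp add: direct_power_def)
  have zero_app: "\<zero>\<^bsub>?P\<^esub> i = \<zero>\<^bsub>X\<^esub>" if "i \<in> \<Lambda>" for i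
    using that by (simp add: direct_power_def)
  note app = add_app smult_app zero_app
  have neg: "\<exists>g\<in>carrier ?P. g \<oplus>\<^bsub>?P\<^esub> f = \<zero>\<^bsub>?P\<^esub>" if f: "f \<in> carrier ?P" for f
  proof
    let ?g = "\<lambda>i\<in>\<Lambda>. \<ominus>\<^bsub>X\<^esub> f i"
    show g: "?g \<in> carrier ?P"
      using f by (intro memI[of _ "{i \<in> \<Lambda>. f i \<noteq> \<zero>\<^bsub>X\<^esub>}"]) (auto simp: closed supp)
    show "?g \<oplus>\<^bsub>?P\<^esub> f = \<zero>\<^bsub>?P\<^esub>"
      using f g by (intro ext) (simp_all add: add_closed zero_closed app closed X.M.l_neg)
  qed
  have "abelian_group ?P"
    by (rule abelian_groupI)
      (simp_all add: add_closed zero_closed neg,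
       (rule ext; simp add: add_closed zero_closed app closed X.M.a_ac)+)
  moreover have "right_module_axioms A ?P"
    by unfold_locales
      (simp_all add: smult_closed,
       (rule ext; simp add: smult_closed add_closed app closed X.smult_add_ring
          X.smult_add_module X.smult_assoc X.smult_one)+)
  ultimately show ?thesis
    by (simp add: right_module_def X.A.ring_axioms)
qed

text \<open>Gives module homomorphisms access to the library facts on kernels and factor groups of
  additive homomorphisms.\<close>

lemma module_hom_abelian_group_hom:
  assumes "right_module A M" "right_module A N" "\<phi> \<in> module_hom A M N"
  shows "abelian_group_hom M N \<phi>"
proof -
  interpret M: right_module A M by fact
  interpret N: right_module A N by fact
  show ?thesis
    using assms(3)
    by (intro abelian_group_homI group_hom.intro group_hom_axioms.intro)
      (auto simp: module_hom_def M.M.abelian_group_axioms N.M.abelian_group_axioms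
        M.M.a_group N.M.a_group)
qed

text \<open>The additive half is the library's; closure under scalars holds because scalars fix the
  zero of \<open>N\<close>.\<close>

lemma submodule_a_kernel:
  assumes "right_module A M" "right_module A N" "\<phi> \<in> module_hom A M N"
  shows "submodule (a_kernel M N \<phi>) A M"
proof -
  interpret M: right_module A M by fact
  interpret N: right_module A N by fact
  interpret abelian_group_hom M N \<phi>
    using assms by (rule module_hom_abelian_group_hom)
  have "submodule_axioms (a_kernel M N \<phi>) A M"
    using assms(3)
    by unfold_locales (auto simp: a_kernel_def' M.smult_closed N.smult_zero module_hom_def)
  then show ?thesis
    using additive_subgroup_a_kernel by (simp add: submodule_def additive_subgroup_def)
qed

text \<open>First isomorphism theorem for modules. Additivity and injectivity come from the version
  for abelian groups; compatibility with scalars is checked by hand.\<close>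

theorem quotient_kernel_isomorphic_image:
  assumes "right_module A M" "right_module A N" and \<phi>: "\<phi> \<in> module_hom A M N"
  shows "module_isomorphic A (quotient_module M (a_kernel M N \<phi>)) (N\<lparr>carrier := \<phi> ` carrier M\<rparr>)"
proof -
  interpret M: right_module A M by fact
  interpret abelian_group_hom M N \<phi>
    using assms by (rule module_hom_abelian_group_hom)
  let ?K = "a_kernel M N \<phi>"
  let ?Q = "quotient_module M ?K"
  \<comment> \<open>\<open>\<phi>\<close> is constant on each coset of its kernel, so
    \<open>the_elem\<close> extracts that value. This is the form of the induced map in
    \<open>A_FactGroup_hom\<close> and \<open>A_FactGroup_inj_on\<close>.\<close>
  let ?h = "\<lambda>X. the_elem (\<phi> ` X)"
  have smult: "\<phi> (a \<odot>\<^bsub>M\<^esub> x) = a \<odot>\<^bsub>N\<^esub> \<phi> x" if "a \<in> carrier A" "x \<in> carrier M" for a x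
    using \<phi> that by (auto simp: module_hom_def)
  have Q: "carrier ?Q = carrier (M A_Mod ?K)"
    by (simp add: quotient_module_def A_FactGroup_def FactGroup_def A_RCOSETS_def)
  have coset: "\<phi> ` (?K +>\<^bsub>M\<^esub> x) = {\<phi> x}" if "x \<in> carrier M" for x
  proof -
    \<comment> \<open>Puts \<open>x\<close> itself into its coset, so that the image is a singleton
      and not empty.\<close>
    have "\<zero>\<^bsub>M\<^esub> \<in> ?K" by (simp add: a_kernel_def')
    then show ?thesis
      using that by (force simp: a_r_coset_def' a_kernel_def')
  qed
  have rep: "\<exists>x\<in>carrier M. X = ?K +>\<^bsub>M\<^esub> x" if "X \<in> carrier ?Q" for X
    using that by (auto simp: quotient_module_def A_RCOSETS_def')
  have image: "?h ` carrier ?Q = \<phi> ` carrier M"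
  proof
    show "?h ` carrier ?Q \<subseteq> \<phi> ` carrier M"
      using rep coset by fastforce
    show "\<phi> ` carrier M \<subseteq> ?h ` carrier ?Q"
    proof
      fix y assume "y \<in> \<phi> ` carrier M"
      then obtain x where x: "x \<in> carrier M" "y = \<phi> x" by auto
      then have "?K +>\<^bsub>M\<^esub> x \<in> carrier ?Q"
        by (auto simp: quotient_module_def A_RCOSETS_def')
      moreover have "y = ?h (?K +>\<^bsub>M\<^esub> x)" using x coset by simp
      ultimately show "y \<in> ?h ` carrier ?Q" by blast
    qed
  qed
  have "?h (X \<oplus>\<^bsub>?Q\<^esub> Y) = ?h X \<oplus>\<^bsub>N\<^esub> ?h Y" if "X \<in> carrier ?Q" "Y \<in> carrier ?Q" for X Y
    using hom_mult[OF A_FactGroup_hom] that by (simp add: Q) (simp add: quotient_module_def)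
  moreover have "?h (a \<odot>\<^bsub>?Q\<^esub> X) = a \<odot>\<^bsub>N\<^esub> ?h X"
    if a: "a \<in> carrier A" and X: "X \<in> carrier ?Q" for a X
  proof -
    obtain x where x: "x \<in> carrier M" "X = ?K +>\<^bsub>M\<^esub> x" using rep[OF X] by blast
    have X': "y \<in> carrier M \<and> \<phi> y = \<phi> x" if "y \<in> X" for y
      using that x by (auto simp: a_r_coset_def' a_kernel_def')
    \<comment> \<open>The scalar multiple of \<open>X\<close> is a union indexed by
      \<open>X\<close>. Each member of the union has the same singleton image; non-emptiness of
      \<open>X\<close> excludes the empty union.\<close>
    have "X \<noteq> {}" using coset[of x] x by auto
    moreover have "\<phi> ` (?K +>\<^bsub>M\<^esub> (a \<odot>\<^bsub>M\<^esub> y)) = {a \<odot>\<^bsub>N\<^esub> \<phi> x}" if "y \<in> X" for y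
      using X'[OF that] a by (simp add: coset M.smult_closed smult)
    ultimately have "\<phi> ` (a \<odot>\<^bsub>?Q\<^esub> X) = {a \<odot>\<^bsub>N\<^esub> \<phi> x}"
      by (simp add: quotient_module_def image_UN)
    then show ?thesis using x coset by simp
  qed
  ultimately have "?h \<in> module_hom A ?Q (N\<lparr>carrier := \<phi> ` carrier M\<rparr>)"
    using image by (auto simp: module_hom_def hom_def)
  moreover have "bij_betw ?h (carrier ?Q) (\<phi> ` carrier M)"
    using A_FactGroup_inj_on image by (simp add: bij_betw_def Q)
  ultimately show ?thesis
    by (auto simp: module_isomorphic_def)
qed

theorem D2_d_rickart_imp_rickart:
  assumes "right_module A M" "D2_module A M" "d_rickart A M"
  shows "rickart A M"
  unfolding rickart_def
proof
  fix \<phi> assume \<phi>: "\<phi> \<in> module_End A M"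
  then have "direct_summand A M (\<phi> ` carrier M)"
    using assms(3) by (simp add: d_rickart_def)
  then show "direct_summand A M (a_kernel M M \<phi>)"
    \<comment> \<open>The summand \<open>K\<close> in the D2 condition is instantiated with the
      image of \<open>\<phi>\<close>.\<close>
    using assms(2) submodule_a_kernel[OF assms(1,1) \<phi>]
      quotient_kernel_isomorphic_image[OF assms(1,1) \<phi>]
    unfolding D2_module_def by blast
qed

theorem proposition4p9:
  fixes A :: "('a, 'r) ring_scheme" and M :: "('a, 'm, 's) module_scheme"
  assumes "right_module A M"
    and "Sigma_D2 TYPE('i) A M"
    and "Sigma_d_rickart TYPE('i) A M"
  shows "Sigma_rickart TYPE('i) A M"
  using assms
  by (simp add: Sigma_D2_def Sigma_d_rickart_def Sigma_rickart_def
      D2_d_rickart_imp_rickart right_module_direct_power)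

end
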